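(* Let $p$ and $q$ be primes satisfying $p<q$, and let $M=p^sq^t$ where $s$ and $t$ are positive integers. For any integers $0\le j<i<M$, there exists $u(x)\in\mathbb{Z}[x]/\Phi_M(x)$ such that $(x^i-x^j)\cdot u(x)=c\pmod{\Phi_M(x)}$ and $\|u(x)\|_\infty\le d$, where $$(c,d)=\begin{cases}(q,\,q-1) & \text{if } p^s\mid (i-j),\\ (p,\,p-1) & \text{if } q^t\mid (i-j),\\ (1,\,p-1) & \text{otherwise.}\end{cases}$$
   Context: $\Phi_M(x)$ denotes the $M$th cyclotomic polynomial, of degree $\phi(M)$ (Euler's totient). $\mathbb{Z}[x]/\Phi_M(x)$ is the quotient of $\mathbb{Z}[x]$ by the ideal generated by $\Phi_M(x)$. For $g\in\mathbb{Z}[x]/\Phi_M(x)$, $\|g\|_\infty$ is the largest absolute value of the coefficients of the unique representative of $g$ in $\mathbb{Z}[x]$ of degree less than $\phi(M)$. *)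

theory Defs
  imports
    "HOL-Algebra.Algebraic_Closure_Type"
    "HOL-Number_Theory.Totient"
    "HOL-Computational_Algebra.Polynomial"
    Complex_Main
begin

text \<open>
  The product over the primitive \<open>n\<close>-th roots of unity \<open>exp (2 \<pi> i k / n)\<close> with
  \<open>k\<close> coprime to \<open>n\<close>.
\<close>

definition complex_cyclotomic :: "nat \<Rightarrow> complex poly" where
  "complex_cyclotomic n =
     (\<Prod>k\<in>totatives n. [:- cis (2 * pi * real k / real n), 1:])"

text \<open>
  Existence of the integer polynomial is \<open>of_int_cyclotomic_poly\<close> below; uniqueness is
  injectivity of the coefficient embedding.
\<close>

definition cyclotomic_poly :: "nat \<Rightarrow> int poly" where
  "cyclotomic_poly n = (THE P. map_poly of_int P = complex_cyclotomic n)"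

abbreviation int_poly_ring :: "int poly ring" (\<open>\<int>[x]\<close>) where
  "\<int>[x] \<equiv> ring_of_type_algebra"

definition cyclotomic_ideal :: "nat \<Rightarrow> int poly set" where
  "cyclotomic_ideal M = Idl\<^bsub>\<int>[x]\<^esub> {cyclotomic_poly M}"

definition cyclotomic_ring :: "nat \<Rightarrow> int poly set ring" where
  "cyclotomic_ring M = \<int>[x] Quot cyclotomic_ideal M"

definition cyclotomic_class :: "nat \<Rightarrow> int poly \<Rightarrow> int poly set" where
  "cyclotomic_class M f = cyclotomic_ideal M +>\<^bsub>\<int>[x]\<^esub> f"

text \<open>
  Elements of the quotient are cosets, so a representative of \<open>g\<close> is an element of \<open>g\<close>.
  For \<open>M > 0\<close> and \<open>g\<close> in the quotient ring, existence and uniqueness of the reduced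
  representative is \<open>ex1_reduced_rep\<close> below.
\<close>

definition reduced_rep :: "nat \<Rightarrow> int poly set \<Rightarrow> int poly" where
  "reduced_rep M g = (THE r. r \<in> g \<and> Polynomial.degree r < totient M)"

definition inf_norm :: "nat \<Rightarrow> int poly set \<Rightarrow> int" where
  "inf_norm M g = (MAX k\<in>{..<totient M}. \<bar>Polynomial.coeff (reduced_rep M g) k\<bar>)"


subsection \<open>Well-definedness\<close>

abbreviation cpoly :: "int poly \<Rightarrow> complex poly" where
  "cpoly \<equiv> map_poly of_int"

lemma coeff_cpoly: "Polynomial.coeff (cpoly P) k = of_int (Polynomial.coeff P k)"
  by (simp add: coeff_map_poly)

lemma cpoly_mult: "cpoly (P * Q) = cpoly P * cpoly Q"
  by (rule poly_eqI) (simp add: coeff_cpoly coeff_mult)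

lemma cpoly_add: "cpoly (P + Q) = cpoly P + cpoly Q"
  by (rule poly_eqI) (simp add: coeff_cpoly)

lemma cpoly_diff: "cpoly (P - Q) = cpoly P - cpoly Q"
  by (rule poly_eqI) (simp add: coeff_cpoly)

lemma cpoly_prod: "cpoly (\<Prod>i\<in>A. f i) = (\<Prod>i\<in>A. cpoly (f i))"
  by (induction A rule: infinite_finite_induct) (simp_all add: cpoly_mult)

lemma cpoly_eq_iff: "cpoly P = cpoly Q \<longleftrightarrow> P = Q"
  by (simp add: poly_eq_iff coeff_cpoly)

lemma degree_cpoly: "Polynomial.degree (cpoly P) = Polynomial.degree P"
  by (intro degree_map_poly) auto

lemma complex_cyclotomic_degree: "Polynomial.degree (complex_cyclotomic n) = totient n"
  unfolding complex_cyclotomic_def totient_def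
  by (subst degree_prod_eq_sum_degree) auto

lemma complex_cyclotomic_monic: "lead_coeff (complex_cyclotomic n) = 1"
  unfolding complex_cyclotomic_def lead_coeff_prod by simp

lemma complex_cyclotomic_nz: "complex_cyclotomic n \<noteq> 0"
  using complex_cyclotomic_monic[of n] by force

lemma prod_all_roots:
  assumes "n > 0"
  shows "(\<Prod>k\<in>{0<..n}. [:- cis (2 * pi * real k / real n), 1:]) = Polynomial.monom 1 n - 1"
    (is "?L = ?R")
proof (rule poly_eqI_degree_lead_coeff[where n = n and A = "{z. z ^ n = 1}"])
  have dl: "Polynomial.degree ?L = n"
    by (subst degree_prod_eq_sum_degree) auto
  then show "Polynomial.degree ?L \<le> n" by simp
  show "Polynomial.degree ?R \<le> n"
    by (intro degree_diff_le degree_monom_le) simp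
  have "lead_coeff ?L = 1"
    unfolding lead_coeff_prod by simp
  with dl show "Polynomial.coeff ?L n = Polynomial.coeff ?R n"
    using assms by simp
  show "n \<le> card {z::complex. z ^ n = 1}"
    using card_roots_unity_eq[OF assms] by simp
  show "poly ?L z = poly ?R z" if "z \<in> {z. z ^ n = 1}" for z
  proof -
    from that bij_betw_roots_unity[OF assms] obtain k where
      k: "k < n" "z = cis (2 * pi * real k / real n)"
      unfolding bij_betw_def by blast
    have "\<exists>k\<in>{0<..n}. z = cis (2 * pi * real k / real n)"
    proof (cases "k = 0")
      case True
      with k assms show ?thesis by (intro bexI[of _ n]) auto
    next
      case False
      with k show ?thesis by (intro bexI[of _ k]) auto
    qed
    then have "poly ?L z = 0"
      by (auto simp: poly_prod)
    with that show ?thesis by (simp add: poly_monom)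
  qed
qed

lemma prod_complex_cyclotomic:
  assumes "n > 0"
  shows "(\<Prod>d | d dvd n. complex_cyclotomic d) = Polynomial.monom 1 n - 1"
proof -
  let ?f = "\<lambda>k. [:- cis (2 * pi * real k / real n), 1:]"
  have fin: "finite {d. d dvd n}" using assms by simp
  have "(\<Prod>d | d dvd n. complex_cyclotomic d) = (\<Prod>d | d dvd n. complex_cyclotomic (n div d))"
    using assms
    by (intro prod.reindex_bij_witness[of _ "\<lambda>d. n div d" "\<lambda>d. n div d"])
       (auto simp: div_dvd_iff_mult div_div_eq_right)
  also have "\<dots> = (\<Prod>d | d dvd n. \<Prod>k\<in>{k\<in>{0<..n}. gcd k n = d}. ?f k)"
  proof (rule prod.cong[OF refl])
    fix d assume "d \<in> {d. d dvd n}"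
    then have d: "d dvd n" by simp
    then have d0: "d > 0" using assms by (auto intro: Nat.gr0I)
    have "complex_cyclotomic (n div d) = (\<Prod>k\<in>totatives (n div d). ?f (k * d))"
      unfolding complex_cyclotomic_def
      using d d0 by (intro prod.cong) (auto simp: real_of_nat_div field_simps)
    also have "\<dots> = (\<Prod>k\<in>{k\<in>{0<..n}. gcd k n = d}. ?f k)"
      using bij_betw_totatives_gcd_eq[OF d assms] by (rule prod.reindex_bij_betw)
    finally show "complex_cyclotomic (n div d) = (\<Prod>k\<in>{k\<in>{0<..n}. gcd k n = d}. ?f k)" .
  qed
  also have "\<dots> = (\<Prod>k\<in>{0<..n}. ?f k)"
    using fin by (intro prod.group) auto
  finally show ?thesis using prod_all_roots[OF assms] by simp
qed

lemma ex_int_cyclotomic: "\<exists>P. cpoly P = complex_cyclotomic n"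
proof (induction n rule: less_induct)
  case (less n)
  show ?case
  proof (cases "n = 0")
    case True
    then show ?thesis
      by (intro exI[of _ 1]) (simp add: complex_cyclotomic_def)
  next
    case False
    let ?D = "{d. d dvd n \<and> d \<noteq> n}"
    have fin: "finite ?D" using False by (auto intro: finite_subset[of _ "{d. d dvd n}"])
    have "\<forall>d\<in>?D. \<exists>P. cpoly P = complex_cyclotomic d"
      using less False by (auto dest: dvd_imp_le intro: le_neq_trans)
    then obtain P where P: "\<And>d. d \<in> ?D \<Longrightarrow> cpoly (P d) = complex_cyclotomic d"
      by metis
    define Q where "Q = (\<Prod>d\<in>?D. P d)"
    have cQ: "cpoly Q = (\<Prod>d\<in>?D. complex_cyclotomic d)"
      unfolding Q_def cpoly_prod using P by (intro prod.cong) auto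
    have "lead_coeff (cpoly Q) = 1"
      unfolding cQ lead_coeff_prod by (simp add: complex_cyclotomic_monic)
    then have lQ: "lead_coeff Q = 1" by (simp add: degree_cpoly coeff_cpoly)
    then have Q0: "Q \<noteq> 0" by force
    obtain g r where gr: "pseudo_divmod (Polynomial.monom 1 n - 1) Q = (g, r)"
      by force
    from pseudo_divmod[OF Q0 gr] lQ
    have eq: "Polynomial.monom 1 n - 1 = Q * g + r"
      and r: "r = 0 \<or> Polynomial.degree r < Polynomial.degree Q"
      by auto
    have "{d. d dvd n} = insert n ?D" by auto
    then have "Polynomial.monom 1 n - 1 = complex_cyclotomic n * cpoly Q"
      using prod_complex_cyclotomic[of n] False fin by (simp add: cQ)
    moreover have "cpoly (Polynomial.monom 1 n - 1) = Polynomial.monom 1 n - 1"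
      by (simp add: cpoly_diff map_poly_monom)
    ultimately have "cpoly r = cpoly Q * (complex_cyclotomic n - cpoly g)"
      using eq by (simp add: cpoly_add cpoly_mult algebra_simps)
    moreover have "cpoly r = 0 \<or> Polynomial.degree (cpoly r) < Polynomial.degree (cpoly Q)"
      using r by (auto simp: degree_cpoly)
    moreover have "cpoly Q \<noteq> 0" using Q0 cpoly_eq_iff[of Q 0] by simp
    ultimately have "complex_cyclotomic n - cpoly g = 0"
      using degree_mult_eq[of "cpoly Q" "complex_cyclotomic n - cpoly g"] by fastforce
    then show ?thesis by (intro exI[of _ g]) simp
  qed
qed

lemma of_int_cyclotomic_poly: "map_poly of_int (cyclotomic_poly n) = complex_cyclotomic n"
proof -
  have "\<exists>!P. cpoly P = complex_cyclotomic n"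
    using ex_int_cyclotomic[of n] by (metis cpoly_eq_iff)
  then show ?thesis unfolding cyclotomic_poly_def by (rule theI')
qed

lemma degree_cyclotomic_poly: "Polynomial.degree (cyclotomic_poly n) = totient n"
  using complex_cyclotomic_degree[of n] of_int_cyclotomic_poly[of n] degree_cpoly by metis

lemma monic_cyclotomic_poly: "lead_coeff (cyclotomic_poly n) = 1"
proof -
  have "of_int (lead_coeff (cyclotomic_poly n)) = (1::complex)"
    using complex_cyclotomic_monic[of n] of_int_cyclotomic_poly[of n]
      degree_cpoly coeff_cpoly by metis
  then show ?thesis by simp
qed

lemma cyclotomic_ideal_eq: "cyclotomic_ideal M = range (\<lambda>h. h * cyclotomic_poly M)"
proof -
  interpret R: cring "\<int>[x]" by (rule cring_from_type_algebra)
  have "cyclotomic_ideal M = PIdl\<^bsub>\<int>[x]\<^esub> (cyclotomic_poly M)"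
    unfolding cyclotomic_ideal_def
    by (rule R.cgenideal_eq_genideal[symmetric]) (simp add: ring_of_type_algebra_def)
  then show ?thesis
    by (auto simp: cgenideal_def ring_of_type_algebra_def)
qed

lemma cyclotomic_class_eq: "cyclotomic_class M f = {g. cyclotomic_poly M dvd g - f}"
proof -
  have "g \<in> cyclotomic_class M f \<longleftrightarrow> (\<exists>h. g = h * cyclotomic_poly M + f)" for g
    unfolding cyclotomic_class_def cyclotomic_ideal_eq a_r_coset_def r_coset_def
    by (auto simp: ring_of_type_algebra_def)
  moreover have "(\<exists>h. g = h * cyclotomic_poly M + f) \<longleftrightarrow> cyclotomic_poly M dvd g - f" for g
    by (auto simp: dvd_def algebra_simps)
  ultimately show ?thesis by blast
qed

lemma carrier_cyclotomic_ring: "carrier (cyclotomic_ring M) = range (cyclotomic_class M)"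
  unfolding cyclotomic_ring_def cyclotomic_class_def
  by (auto simp: FactRing_def A_RCOSETS_def' ring_of_type_algebra_def)

lemma ex1_reduced_rep:
  assumes "M > 0" and "g \<in> carrier (cyclotomic_ring M)"
  shows "\<exists>!r. r \<in> g \<and> Polynomial.degree r < totient M"
proof -
  let ?C = "cyclotomic_poly M"
  from assms(2) obtain f where g: "g = {h. ?C dvd h - f}"
    by (auto simp: carrier_cyclotomic_ring cyclotomic_class_eq)
  have C0: "?C \<noteq> 0" using monic_cyclotomic_poly[of M] by force
  obtain h r where hr: "pseudo_divmod f ?C = (h, r)" by force
  from pseudo_divmod[OF C0 hr]
  have eq: "f = ?C * h + r" and r: "r = 0 \<or> Polynomial.degree r < Polynomial.degree ?C"
    by (auto simp: monic_cyclotomic_poly)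
  show ?thesis
  proof (rule ex1I[of _ r])
    show "r \<in> g \<and> Polynomial.degree r < totient M"
      using eq r assms(1) by (auto simp: g degree_cyclotomic_poly)
  next
    fix r' assume r': "r' \<in> g \<and> Polynomial.degree r' < totient M"
    have "?C dvd (r' - f) + ?C * h" using r' by (intro dvd_add) (auto simp: g)
    then have "?C dvd r' - r" by (simp add: eq)
    moreover have "Polynomial.degree (r' - r) < Polynomial.degree ?C"
      using r' r by (auto simp: degree_cyclotomic_poly intro: degree_diff_less)
    ultimately have "r' - r = 0" by (metis dvd_imp_degree_le linorder_not_less)
    then show "r' = r" by simp
  qed
qed

end

theory Submission
  imports Defs
begin

text \<open>
  Put \<open>k = i - j\<close>, \<open>g = gcd k M\<close> and \<open>N = M / g\<close>, so that \<open>\<omega> = x ^ k\<close> has order \<open>N\<close>. Summation by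
  parts gives \<open>(\<omega> - 1) \<Sum>r<N. \<lfloor>r q / N\<rfloor> \<omega> ^ r = q\<close> if \<open>q\<close> divides \<open>N\<close>, and likewise for \<open>p\<close>; in the
  third case the two are combined with Bezout coefficients \<open>a q + b p = 1\<close>. Multiplying by \<open>x ^ (- j)\<close>
  only rotates exponents in \<open>\<int>[x] / (x ^ M - 1)\<close>.

  On a residue class modulo \<open>L = M / (p q)\<close> exponents form a copy of \<open>\<int> / p q\<close>, and reduction modulo
  \<open>\<Phi>\<^sub>M\<close> changes coefficients by \<open>\<alpha> + \<beta>\<close> with \<open>\<alpha>\<close> \<open>p\<close>-periodic and \<open>\<beta>\<close> \<open>q\<close>-periodic, so as to make
  them vanish on the last \<open>p + q - 1\<close> places. As in the theorem of Fine and Wilf, such a window connects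
  all residues modulo \<open>p\<close> and modulo \<open>q\<close>, so values of \<open>\<alpha>\<close> and \<open>\<beta>\<close> cannot spread much. If \<open>p ^ s\<close>
  divides \<open>k\<close>, the unreduced coefficients lie in \<open>{0..q - 1}\<close> and live on one class modulo \<open>p\<close>. In
  the third case, up to such an \<open>\<alpha> + \<beta>\<close>, they are the fractions \<open>r / N\<close> in \<open>[0, 1)\<close>, and connecting
  \<open>p\<close> residues costs less than \<open>p\<close>.
\<close>

subsection \<open>Sums of two periodic functions\<close>

definition periodic :: "int \<Rightarrow> (int \<Rightarrow> 'a) \<Rightarrow> bool" where
  "periodic P f \<longleftrightarrow> (\<forall>n. f (n + P) = f n)"

lemma periodic_mult:
  assumes "periodic P f"
  shows "f (n + m * P) = f n"
proof (induction m rule: int_induct[of _ 0])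
  case (step1 m)
  then show ?case
    using assms[unfolded periodic_def, rule_format, of "n + m * P"] by (simp add: algebra_simps)
next
  case (step2 m)
  then show ?case
    using assms[unfolded periodic_def, rule_format, of "n + (m - 1) * P"] by (simp add: algebra_simps)
qed simp

lemma periodic_mod:
  assumes "periodic P f"
  shows "f (n mod P) = f n"
  using periodic_mult[OF assms, of "n mod P" "n div P"] by simp

text \<open>Modulo \<open>p + q\<close> a step by \<open>q\<close> is either a step by
  \<open>q\<close> or a step back by \<open>p\<close>. As \<open>q\<close> is coprime to
  \<open>p + q\<close>, such steps form one cycle through all residues; removing the single residue
  outside the window leaves a path through the whole window.\<close>

lemma window_constant:
  fixes p q :: nat
  assumes "coprime p q" "p > 0" "q > 0"
    and A: "\<And>e. 0 \<le> e \<Longrightarrow> e + int p < int (p + q) - 1 \<Longrightarrow> S (e + int p) = S e"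
    and B: "\<And>e. 0 \<le> e \<Longrightarrow> e + int q < int (p + q) - 1 \<Longrightarrow> S (e + int q) = S e"
    and e: "0 \<le> e" "e < int (p + q) - 1"
  shows "S e = S (int q - 1)"
proof -
  define m where "m = int (p + q)"
  \<comment> \<open>The walk starts at -1, the only residue outside the window, so it stays inside
    for \<open>0 < k < p + q\<close>.\<close>
  define w where "w k = (int k * int q - 1) mod m" for k
  have cop: "coprime m (int q)"
    using assms(1) by (simp add: m_def coprime_iff_gcd_eq_1 gcd_add1)
  have m0: "m > 0" using assms by (simp add: m_def)
  have wr: "0 \<le> w k" "w k < m" for k using m0 by (auto simp: w_def)
  have wne: "w k \<noteq> m - 1" if "0 < k" "int k < m" for k
  proof
    assume "w k = m - 1"
    then have "(int k * int q - 1) mod m = (- 1) mod m" using m0 by (simp add: w_def zmod_minus1)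
    then have "m dvd int k * int q" by (metis diff_conv_add_uminus mod_eq_dvd_iff add_diff_cancel_right')
    then have "m dvd int k" using cop coprime_dvd_mult_left_iff by blast
    with that show False using zdvd_imp_le by fastforce
  qed
  have walk: "S (w (Suc k)) = S (w 1)" if "int (Suc k) < m" for k
    using that
  proof (induction k)
    case (Suc k)
    have n1: "w (Suc k) \<noteq> m - 1" and n2: "w (Suc (Suc k)) \<noteq> m - 1"
      using Suc.prems wne[of "Suc k"] wne[of "Suc (Suc k)"] by auto
    have eq: "w (Suc (Suc k)) = (w (Suc k) + int q) mod m"
      by (simp add: w_def mod_simps algebra_simps)
    have "S (w (Suc (Suc k))) = S (w (Suc k))"
    proof (cases "w (Suc k) + int q < m")
      case True
      then have "w (Suc (Suc k)) = w (Suc k) + int q" using eq wr[of "Suc k"] by simp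
      then show ?thesis using B[of "w (Suc k)"] wr[of "Suc (Suc k)"] wr[of "Suc k"] n2 by (simp add: m_def)
    next
      case False
      then have "w (Suc (Suc k)) = w (Suc k) + int q - m"
        using eq wr[of "Suc k"] \<open>p > 0\<close>
        by (smt (verit, best) m_def mod_add_self2 mod_pos_pos_trivial of_nat_add of_nat_0_less_iff minus_mod_self2)
      then show ?thesis using A[of "w (Suc (Suc k))"] wr[of "Suc (Suc k)"] wr[of "Suc k"] n1
        by (simp add: m_def)
    qed
    then show ?case using Suc by simp
  qed simp
  have w1: "w 1 = int q - 1" using assms by (simp add: w_def m_def)
  obtain v where v: "[int q * v = 1] (mod m)"
    using cong_solve_coprime_int[of "int q" m] cop by (auto simp: coprime_commute)
  \<comment> \<open>The time at which the walk reaches \<open>e\<close>, from solving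
    \<open>k q = e + 1\<close> modulo \<open>m\<close>.\<close>
  define k where "k = nat (((e + 1) * v) mod m)"
  have ki: "int k = ((e + 1) * v) mod m" using m0 by (simp add: k_def)
  have "[int k * int q = (e + 1) * v * int q] (mod m)"
    by (simp add: ki cong_def mod_mult_left_eq)
  also have "[(e + 1) * v * int q = (e + 1) * 1] (mod m)"
    using cong_scalar_left[OF v, of "e + 1"] by (simp add: mult.assoc mult.commute[of v])
  finally have "[int k * int q - 1 = e + 1 - 1] (mod m)" by (intro cong_diff) auto
  then have "w k = e" using e by (simp add: w_def cong_def m_def)
  have "int k < m" using m0 ki by simp
  have "k > 0"
  proof (rule Nat.gr0I)
    assume "k = 0"
    then have "w k = m - 1" using m0 by (simp add: w_def zmod_minus1)
    then show False using \<open>w k = e\<close> e by (simp add: m_def)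
  qed
  then obtain k' where "k = Suc k'" by (cases k) auto
  with walk[of k'] \<open>int k < m\<close> \<open>w k = e\<close> w1 show ?thesis by simp
qed

text \<open>Within the window \<open>A\<close> is invariant under steps of \<open>p\<close> by
  periodicity and under steps of \<open>q\<close> through \<open>B\<close>, so it is constant there.
  The window meets all residues modulo \<open>p\<close> and modulo \<open>q\<close>, which spreads
  the truth of \<open>A a\<close> everywhere.\<close>

lemma periodic_window_cut:
  fixes p q :: nat and A B :: "int \<Rightarrow> bool"
  assumes "coprime p q" "p > 0" "q > 0"
    and A: "periodic (int p) A" and B: "periodic (int q) B"
    and AB: "\<And>e. N \<le> e \<Longrightarrow> e < N + int (p + q) - 1 \<Longrightarrow> A e = B e"
    and "A a"
  shows "A n" "B n"
proof -
  have c: "A (N + e) = A (N + (int q - 1))" if "0 \<le> e" "e < int (p + q) - 1" for e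
  proof (rule window_constant[OF assms(1-3), where S = "\<lambda>e. A (N + e)"])
    show "A (N + (e + int p)) = A (N + e)" for e
      using A by (simp add: periodic_def flip: add.assoc)
    show "A (N + (e + int q)) = A (N + e)" if "0 \<le> e" "e + int q < int (p + q) - 1" for e
      using AB[of "N + e"] AB[of "N + (e + int q)"] B that
      by (simp add: periodic_def flip: add.assoc)
  qed (use that in auto)
  have red: "\<exists>e. 0 \<le> e \<and> e < int P \<and> f n = f (N + e)"
    if "periodic (int P) f" "P > 0" for f :: "int \<Rightarrow> bool" and n P
  proof (intro exI[of _ "(n - N) mod int P"] conjI)
    show "f n = f (N + (n - N) mod int P)"
      using periodic_mult[OF that(1), of "N + (n - N) mod int P" "(n - N) div int P"] by simp
  qed (use that in auto)
  have W: "A (N + e)" if "0 \<le> e" "e < int (p + q) - 1" for e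
  proof -
    obtain e' where "0 \<le> e'" "e' < int p" "A a = A (N + e')" using red[OF A] assms by blast
    then show ?thesis using c[of e] c[of e'] that assms by auto
  qed
  show "A n" using red[OF A \<open>p > 0\<close>, of n] W assms by fastforce
  obtain e where "0 \<le> e" "e < int q" "B n = B (N + e)" using red[OF B \<open>q > 0\<close>] by blast
  then show "B n" using W[of e] AB[of "N + e"] assms by auto
qed

text \<open>In the window \<open>\<beta> = - \<alpha>\<close> off the class of \<open>a\<close>, and
  \<open>\<alpha> a + \<beta>\<close> equals \<open>C\<close> on it. Membership of
  \<open>\<alpha> a - \<alpha> n\<close> and \<open>\<alpha> a + \<beta> n\<close> in
  \<open>{0..b}\<close> therefore spreads to all \<open>n\<close>, and \<open>F n\<close> is always
  a difference of two numbers in \<open>{0..b}\<close>.\<close>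

lemma bound_single_class:
  fixes p q :: nat and F C \<alpha> \<beta> :: "int \<Rightarrow> real"
  assumes pq: "coprime p q" "p > 0" "q > 0"
    and \<alpha>: "periodic (int p) \<alpha>" and \<beta>: "periodic (int q) \<beta>"
    and F: "\<And>n. F n = C n - \<alpha> n - \<beta> n"
    and window: "\<And>e. N \<le> e \<Longrightarrow> e < N + int (p + q) - 1 \<Longrightarrow> F e = 0"
    and C: "\<And>n. 0 \<le> C n" "\<And>n. C n \<le> b"
    and C0: "\<And>n. n mod int p \<noteq> a mod int p \<Longrightarrow> C n = 0"
  shows "\<bar>F n\<bar> \<le> b"
proof -
  define A where "A n \<longleftrightarrow> n mod int p = a mod int p \<or> \<alpha> a - \<alpha> n \<in> {0..b}" for n
  define B where "B n \<longleftrightarrow> \<alpha> a + \<beta> n \<in> {0..b}" for n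
  have eqa: "\<alpha> n = \<alpha> a" if "n mod int p = a mod int p" for n
    using periodic_mod[OF \<alpha>] that by metis
  have pA: "periodic (int p) A" using \<alpha> by (simp add: A_def periodic_def)
  have pB: "periodic (int q) B" using \<beta> by (simp add: B_def periodic_def)
  have AB: "A e = B e" if "N \<le> e" "e < N + int (p + q) - 1" for e
  proof (cases "e mod int p = a mod int p")
    case True
    then show ?thesis using window[OF that] F[of e] eqa[OF True] C[of e] by (auto simp: A_def B_def)
  next
    case False
    then show ?thesis using window[OF that] F[of e] C0[OF False] by (auto simp: A_def B_def)
  qed
  have "A a" by (simp add: A_def)
  then have "A n" "B n" using periodic_window_cut[OF pq pA pB AB] by blast+
  then show ?thesis
    using F[of n] C[of n] eqa[of n] C0[of n] unfolding A_def B_def atLeastAtMost_iff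
    by (cases "n mod int p = a mod int p") linarith+
qed

text \<open>If some unit interval between two values of \<open>\<alpha>\<close> contained no value of \<open>\<alpha>\<close>, it would cut
  the residues in two parts that the window does not connect.\<close>

lemma bound_unit_interval:
  fixes p q :: nat and F \<rho> \<alpha> \<beta> :: "int \<Rightarrow> real"
  assumes pq: "coprime p q" "p > 0" "q > 0"
    and \<alpha>: "periodic (int p) \<alpha>" and \<beta>: "periodic (int q) \<beta>"
    and F: "\<And>n. F n = \<rho> n - \<alpha> n - \<beta> n"
    and window: "\<And>e. N \<le> e \<Longrightarrow> e < N + int (p + q) - 1 \<Longrightarrow> F e = 0"
    and \<rho>: "\<And>n. 0 \<le> \<rho> n" "\<And>n. \<rho> n < 1"
  shows "\<bar>F n\<bar> < p"
proof -
  \<comment> \<open>The values of \<open>\<alpha>\<close> cost at most \<open>p - 1\<close>; the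
    rest of the bound comes from two values of \<open>\<rho>\<close>, which differ by less than
    1.\<close>
  have spread: "\<alpha> y - \<alpha> x \<le> real p - 1" for x y
  proof (rule ccontr)
    assume far: "\<not> \<alpha> y - \<alpha> x \<le> real p - 1"
    \<comment> \<open>\<open>f n = k\<close> means that the offset from \<open>\<alpha> x\<close>
      lies in \<open>(k - 1, k]\<close>. If all of \<open>0..<p\<close> are hit while
      \<open>f y\<close> is at least \<open>p\<close>, then \<open>f\<close> takes
      \<open>p + 1\<close> values on \<open>p\<close> residues.\<close>
    define f where "f n = \<lceil>\<alpha> n - \<alpha> x\<rceil>" for n
    have hit: "k \<in> range f" if "0 \<le> k" "k < int p" for k
    proof (rule ccontr)
      assume no: "k \<notin> range f"
      then have "k \<noteq> f x" by blast
      then have k0: "k > 0" using that by (simp add: f_def)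
      define A where "A n \<longleftrightarrow> \<alpha> n - \<alpha> x \<le> real_of_int k - 1" for n
      define B where "B n \<longleftrightarrow> \<alpha> x + \<beta> n \<ge> 1 - real_of_int k" for n
      have pA: "periodic (int p) A" using \<alpha> by (simp add: A_def periodic_def)
      have pB: "periodic (int q) B" using \<beta> by (simp add: B_def periodic_def)
      have gap: "\<alpha> n - \<alpha> x > real_of_int k" if "\<not> A n" for n
      proof (rule ccontr)
        assume "\<not> \<alpha> n - \<alpha> x > real_of_int k"
        then have "f n = k" using that unfolding f_def A_def by (intro ceiling_unique) auto
        then show False using no by blast
      qed
      \<comment> \<open>In the window \<open>\<alpha> + \<beta> = \<rho>\<close> lies in
        \<open>[0, 1)\<close>; a gap of width 1 in the values of \<open>\<alpha>\<close> absorbs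
        this uncertainty.\<close>
      have AB: "A e = B e" if "N \<le> e" "e < N + int (p + q) - 1" for e
        using window[OF that] F[of e] \<rho>[of e] gap[of e] by (cases "A e") (auto simp: A_def B_def)
      have "A x" using k0 by (simp add: A_def)
      then have "A y" using periodic_window_cut(1)[OF pq pA pB AB] by blast
      then show False using far that unfolding A_def by linarith
    qed
    have rng: "range f = f ` {0..<int p}"
    proof -
      have "f n = f (n mod int p)" for n using \<alpha> by (metis f_def periodic_mod)
      then show ?thesis using \<open>p > 0\<close> by (auto simp: image_iff) (metis Euclidean_Rings.pos_mod_bound Euclidean_Rings.pos_mod_sign atLeastLessThan_iff of_nat_0_less_iff)
    qed
    have "f y \<notin> {0..<int p}" using far unfolding f_def by (simp, linarith)
    then have "card (insert (f y) {0..<int p}) = Suc p" by simp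
    moreover have "card (insert (f y) {0..<int p}) \<le> card (f ` {0..<int p})"
      using hit rng by (intro card_mono) auto
    moreover have "card (f ` {0..<int p}) \<le> p" using card_image_le[of "{0..<int p}" f] by simp
    ultimately show False by simp
  qed
  \<comment> \<open>The representative of \<open>n\<close> modulo \<open>q\<close> in the window:
    there \<open>\<beta> n = \<rho> e - \<alpha> e\<close>, so \<open>F n\<close> is
    \<open>\<rho> n - \<rho> e\<close> minus \<open>\<alpha> n - \<alpha> e\<close>.\<close>
  define e where "e = N + (n - N) mod int q"
  have "0 \<le> (n - N) mod int q" "(n - N) mod int q < int q" "int p \<ge> 1" using pq by auto
  then have e: "N \<le> e" "e < N + int (p + q) - 1" unfolding e_def by linarith+
  have "\<beta> e = \<beta> n"
    using periodic_mult[OF \<beta>, of e "(n - N) div int q"] by (simp add: e_def)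
  then show ?thesis
    using window[OF e] F[of e] F[of n] \<rho>[of e] \<rho>[of n] spread[of e n] spread[of n e]
    by linarith
qed

text \<open>Write \<open>n = n u q + n v p\<close> with \<open>u q + v p = 1\<close>. The vanishing
  mixed difference makes increments of \<open>G\<close> along multiples of \<open>q\<close>
  unaffected by steps of \<open>p\<close>, so the two summands contribute independently.\<close>

lemma periodic_split:
  fixes G :: "int \<Rightarrow> real" and p q :: int
  assumes "coprime p q" and per: "periodic (p * q) G"
    and dd: "\<And>n. G n - G (n - p) - G (n - q) + G (n - p - q) = 0"
  obtains \<alpha> \<beta> where "periodic p \<alpha>" "periodic q \<beta>" "\<And>n. G n = \<alpha> n + \<beta> n"
proof -
  obtain u v where uv: "u * q + v * p = 1"
    using bezout_int[of q p] assms(1) by (metis coprime_iff_gcd_eq_1 gcd.commute)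
  have pD: "periodic q (\<lambda>n. G n - G (n - p))"
    unfolding periodic_def
  proof
    fix n show "G (n + q) - G (n + q - p) = G n - G (n - p)"
      using dd[of "n + q"] by (simp add: algebra_simps)
  qed
  have pT: "periodic p (\<lambda>n. G (n + a * q) - G n)" for a
    unfolding periodic_def
  proof
    fix n show "G (n + p + a * q) - G (n + p) = G (n + a * q) - G n"
      using periodic_mult[OF pD, of "n + p" a] by (simp add: algebra_simps)
  qed
  have add: "G (a * q + b * p) = G (a * q) + (G (b * p) - G 0)" for a b
    using periodic_mult[OF pT[of a], of 0 b] by (simp add: algebra_simps)
  show ?thesis
  proof (rule that)
    show "periodic p (\<lambda>n. G (n * u * q))"
      unfolding periodic_def
    proof
      fix n show "G ((n + p) * u * q) = G (n * u * q)"
        using periodic_mult[OF per, of "n * u * q" u] by (simp add: algebra_simps)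
    qed
    show "periodic q (\<lambda>n. G (n * v * p) - G 0)"
      unfolding periodic_def
    proof
      fix n show "G ((n + q) * v * p) - G 0 = G (n * v * p) - G 0"
        using periodic_mult[OF per, of "n * v * p" v] by (simp add: algebra_simps)
    qed
    show "G n = G (n * u * q) + (G (n * v * p) - G 0)" for n
    proof -
      have "n = n * (u * q + v * p)" by (simp add: uv)
      then have "n = n * u * q + n * v * p" by (simp add: algebra_simps)
      then show ?thesis using add[of "n * u" "n * v"] by simp
    qed
  qed
qed

subsection \<open>Roots of the cyclotomic polynomial\<close>

lemma complex_cyclotomic_root_iff:
  "poly (complex_cyclotomic n) z = 0 \<longleftrightarrow> z \<in> (\<lambda>k. cis (2 * pi * real k / real n)) ` totatives n"
  by (auto simp: complex_cyclotomic_def poly_prod)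

lemma card_complex_cyclotomic_roots:
  assumes "n > 1"
  shows "card {z. poly (complex_cyclotomic n) z = 0} = totient n"
proof -
  have "inj_on (\<lambda>k. cis (2 * pi * real k / real n)) (totatives n)"
    using bij_betw_roots_unity[of n] assms totatives_less
    by (auto simp: bij_betw_def intro: inj_on_subset)
  then show ?thesis
    by (simp add: complex_cyclotomic_root_iff totient_def card_image)
qed

lemma complex_cyclotomic_root_power_eq_1_iff:
  assumes "poly (complex_cyclotomic n) z = 0" "n > 0"
  shows "z ^ e = 1 \<longleftrightarrow> n dvd e"
proof -
  obtain l where l: "l \<in> totatives n" "z = cis (2 * pi * real l / real n)"
    using assms by (auto simp: complex_cyclotomic_root_iff)
  have ze: "z ^ e = cis (2 * pi * real (l * e) / real n)"
    by (simp add: l DeMoivre field_simps)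
  have cop: "coprime n l" using l by (simp add: totatives_def coprime_commute)
  show ?thesis
  proof
    assume "z ^ e = 1"
    then have "cos (2 * pi * real (l * e) / real n) = 1" using ze by (simp add: complex_eq_iff)
    then obtain x :: int where "2 * pi * real (l * e) / real n = of_int x * 2 * pi"
      by (auto simp: cos_one_2pi_int)
    then have "real (l * e) = of_int x * real n"
      using assms(2) by (simp add: field_simps)
    then have "of_int (int (l * e)) = (of_int (x * int n) :: real)" by simp
    then have "int (l * e) = x * int n" by (subst (asm) of_int_eq_iff)
    then have "int n dvd int (l * e)" by simp
    then have "n dvd l * e" by (subst (asm) of_nat_dvd_iff)
    then show "n dvd e" using cop by (simp add: coprime_dvd_mult_right_iff)
  next
    assume "n dvd e"
    then obtain m where m: "e = n * m" by blast
    have "2 * pi * real (l * e) / real n = 2 * pi * real (l * m)"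
      using assms(2) by (simp add: m)
    then have "z ^ e = cis (2 * pi * real (l * m))" by (simp only: ze)
    also have "\<dots> = 1" by (rule cis_multiple_2pi) simp
    finally show "z ^ e = 1" .
  qed
qed

text \<open>The cyclotomic polynomial is monic, so division leaves an integral remainder; its degree
  is below \<open>totient n\<close>, yet it vanishes at \<open>totient n\<close> distinct
  points.\<close>

lemma cyclotomic_poly_dvdI:
  assumes "n > 1" and P: "\<And>z. poly (complex_cyclotomic n) z = 0 \<Longrightarrow> poly (cpoly P) z = 0"
  shows "cyclotomic_poly n dvd P"
proof -
  let ?C = "cyclotomic_poly n"
  have C0: "?C \<noteq> 0" using monic_cyclotomic_poly[of n] by force
  obtain h r where hr: "pseudo_divmod P ?C = (h, r)" by force
  from pseudo_divmod[OF C0 hr]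
  have eq: "P = ?C * h + r" and r: "r = 0 \<or> Polynomial.degree r < totient n"
    by (simp_all add: monic_cyclotomic_poly flip: degree_cyclotomic_poly)
  have "cpoly r = 0"
  proof (rule ccontr)
    assume "cpoly r \<noteq> 0"
    then have "Polynomial.degree (cpoly r) < totient n" using r by (auto simp: degree_cpoly)
    then have "cpoly r = 0"
    proof (intro poly_eqI_degree[where A = "{z. poly (complex_cyclotomic n) z = 0}"])
      fix z assume "z \<in> {z. poly (complex_cyclotomic n) z = 0}"
      then show "poly (cpoly r) z = poly 0 z"
        using P[of z] by (simp add: eq cpoly_add cpoly_mult of_int_cyclotomic_poly)
    qed (use assms in \<open>auto simp: card_complex_cyclotomic_roots\<close>)
    with \<open>cpoly r \<noteq> 0\<close> show False by simp
  qed
  then have "r = 0" using cpoly_eq_iff[of r 0] by simp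
  then show ?thesis by (simp add: eq)
qed

subsection \<open>Reduction modulo the cyclotomic polynomial\<close>

text \<open>Multiplying by \<open>z\<close> shifts the coefficients cyclically: the term pushed to
  exponent \<open>M\<close> returns to exponent 0.\<close>

lemma sum_periodic_shift:
  fixes G :: "int \<Rightarrow> complex"
  assumes "periodic (int M) G" "M > 0" "z ^ M = 1"
  shows "(\<Sum>n<M. G (int n - int m) * z ^ n) = z ^ m * (\<Sum>n<M. G (int n) * z ^ n)"
proof (induction m)
  case (Suc m)
  define H where "H n = G (n - int m)" for n
  obtain M' where M': "M = Suc M'" using assms(2) by (cases M) auto
  have "H (- 1 + int M) = H (- 1)"
    using assms(1)[unfolded periodic_def, rule_format, of "- 1 - int m"]
    by (simp add: H_def algebra_simps)
  then have last: "H (int M') = H (- 1)" by (simp add: M')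
  have "(\<Sum>n<M. G (int n - int (Suc m)) * z ^ n) = (\<Sum>n<M. H (int n - 1) * z ^ n)"
    by (simp add: H_def algebra_simps)
  also have "\<dots> = H (- 1) + (\<Sum>n<M'. H (int n) * z ^ Suc n)"
    unfolding M' by (subst sum.lessThan_Suc_shift) simp
  also have "\<dots> = (\<Sum>n<M'. H (int n) * z ^ Suc n) + H (int M') * z ^ M"
    using assms(3) last by simp
  also have "\<dots> = z * (\<Sum>n<M. H (int n) * z ^ n)"
    by (simp add: M' sum_distrib_left algebra_simps)
  finally show ?case using Suc by (simp add: H_def mult.assoc)
qed simp

text \<open>The condition \<open>p \<noteq> q\<close> is symmetric, so the locale can also be
  interpreted with the primes exchanged.\<close>

locale two_prime_powers =
  fixes p q s t M :: nat
  assumes p: "prime p" and q: "prime q" and pq: "p \<noteq> q"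
    and s: "s > 0" and t: "t > 0" and M_eq: "M = p ^ s * q ^ t"
begin

definition L :: nat where "L = p ^ (s - 1) * q ^ (t - 1)"

lemma pos: "p > 1" "q > 1" "L > 0"
  using prime_gt_1_nat[OF p] prime_gt_1_nat[OF q] by (auto simp: L_def)

lemma M_L: "M = p * q * L"
proof -
  have "p ^ s = p * p ^ (s - 1)" "q ^ t = q * q ^ (t - 1)" using s t by (simp_all add: power_eq_if)
  then show ?thesis by (simp add: M_eq L_def)
qed

lemma M_gt_1: "M > 1"
proof -
  have "1 * 1 < p * q * 1" using pos mult_strict_mono[of 1 p 1 q] by simp
  also have "p * q * 1 \<le> M" unfolding M_L using pos by (intro mult_left_mono) auto
  finally show ?thesis by simp
qed

lemma coprime_pq: "coprime p q"
  using p q pq by (rule primes_coprime)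

text \<open>As a multiple of \<open>L\<close>, the degree bound cuts every class modulo
  \<open>L\<close> at the same index \<open>(p - 1) * (q - 1)\<close>.\<close>

lemma totient_M: "totient M = L * ((p - 1) * (q - 1))"
  using p q s t coprime_pq
  by (simp add: M_eq L_def totient_mult_coprime totient_prime_power)

lemma prime_dvd_M: "prime r \<Longrightarrow> r dvd M \<Longrightarrow> r = p \<or> r = q"
  using primes_dvd_imp_eq[OF _ p, of r] primes_dvd_imp_eq[OF _ q, of r]
    prime_dvd_power[of r p s] prime_dvd_power[of r q t]
  unfolding M_eq by (metis prime_dvd_mult_iff)

text \<open>With \<open>z = exp (2 \<pi> i l / M)\<close>, either \<open>l\<close> is coprime to
  \<open>M\<close> and \<open>z\<close> is primitive, or \<open>l\<close> shares with
  \<open>M\<close> a prime factor, which can only be \<open>p\<close> or \<open>q\<close>.\<close>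

lemma root_of_unity_cases:
  assumes "z ^ M = 1"
  shows "poly (complex_cyclotomic M) z = 0 \<or> z ^ (M div p) = 1 \<or> z ^ (M div q) = 1"
proof -
  have "z \<in> (\<lambda>k. cis (2 * pi * real k / real M)) ` {..<M}"
    using bij_betw_roots_unity[of M] M_gt_1 assms by (auto simp: bij_betw_def)
  then obtain l where l: "l < M" "z = cis (2 * pi * real l / real M)" by auto
  have one: "z ^ (M div r) = 1" if r: "r dvd l" "r dvd M" for r
  proof -
    obtain a b where ab: "l = r * a" "M = r * b" using r unfolding dvd_def by blast
    have "r > 0" "b > 0" using ab M_gt_1 by (auto intro: Nat.gr0I)
    then have "real (M div r) * (2 * pi * real l / real M) = 2 * pi * real a"
      by (simp add: ab)
    then have "z ^ (M div r) = cis (2 * pi * real a)" by (simp only: l DeMoivre)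
    also have "\<dots> = 1" by (rule cis_multiple_2pi) simp
    finally show ?thesis .
  qed
  show ?thesis
  proof (cases "coprime l M")
    case True
    then have "l > 0" using M_gt_1 by (intro Nat.gr0I) auto
    then have "l \<in> totatives M" using True l by (simp add: totatives_def)
    then show ?thesis using l by (auto simp: complex_cyclotomic_root_iff)
  next
    case False
    then have "gcd l M \<noteq> 1" by (simp add: coprime_iff_gcd_eq_1)
    then obtain r where "prime r" "r dvd gcd l M" using prime_factor_nat by blast
    then have "r = p \<or> r = q" "r dvd l" "r dvd M" using prime_dvd_M[of r] by auto
    then show ?thesis using one by blast
  qed
qed

text \<open>\<open>x ^ M - 1\<close> divides \<open>(x ^ (M / p) - 1) (x ^ (M / q) - 1) \<Phi>\<^sub>M\<close>.\<close>

lemma second_difference_zero: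
  fixes G :: "int \<Rightarrow> complex"
  assumes per: "periodic (int M) G"
    and G: "\<And>z. poly (complex_cyclotomic M) z = 0 \<Longrightarrow> (\<Sum>n<M. G (int n) * z ^ n) = 0"
  defines "a \<equiv> M div p" and "b \<equiv> M div q"
  shows "G n - G (n - int a) - G (n - int b) + G (n - int a - int b) = 0"
proof -
  define D where "D n = G n - G (n - int a) - G (n - int b) + G (n - int (a + b))" for n
  have perD: "periodic (int M) D"
    unfolding periodic_def
  proof
    fix n show "D (n + int M) = D n"
      using per[unfolded periodic_def, rule_format, of n]
        per[unfolded periodic_def, rule_format, of "n - int a"]
        per[unfolded periodic_def, rule_format, of "n - int b"]
        per[unfolded periodic_def, rule_format, of "n - int (a + b)"]
      unfolding D_def by (simp add: algebra_simps)
  qed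
  define P where "P = (\<Sum>n<M. Polynomial.monom (D (int n)) n)"
  \<comment> \<open>\<open>P\<close> has degree below \<open>M\<close> and vanishes at all
    \<open>M\<close> roots of unity.\<close>
  have "P = 0"
  proof (rule poly_eqI_degree[where A = "{z. z ^ M = 1}"])
    have "Polynomial.degree P < M"
      unfolding P_def using M_gt_1
      by (intro degree_sum_less le_less_trans[OF degree_monom_le]) auto
    then show "Polynomial.degree P < card {z::complex. z ^ M = 1}"
      using M_gt_1 by (simp add: card_roots_unity_eq)
    show "Polynomial.degree 0 < card {z::complex. z ^ M = 1}"
      using M_gt_1 by (simp add: card_roots_unity_eq)
    fix z :: complex assume "z \<in> {z. z ^ M = 1}"
    then have z: "z ^ M = 1" by simp
    define S where "S = (\<Sum>n<M. G (int n) * z ^ n)"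
    have sh: "(\<Sum>n<M. G (int n - int m) * z ^ n) = z ^ m * S" for m
      unfolding S_def using M_gt_1 by (intro sum_periodic_shift per z) auto
    have "poly P z = (\<Sum>n<M. D (int n) * z ^ n)"
      by (simp add: P_def poly_sum poly_monom)
    also have "\<dots> = S - (\<Sum>n<M. G (int n - int a) * z ^ n) - (\<Sum>n<M. G (int n - int b) * z ^ n)
                      + (\<Sum>n<M. G (int n - int (a + b)) * z ^ n)"
      unfolding D_def S_def by (simp only: algebra_simps sum.distrib sum_subtractf)
    \<comment> \<open>Each shift multiplies by a power of \<open>z\<close>, so the sum factors; by
      \<open>root_of_unity_cases\<close> one of the factors vanishes.\<close>
    also have "\<dots> = (1 - z ^ a) * (1 - z ^ b) * S"
      unfolding sh by (simp add: algebra_simps power_add)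
    also have "\<dots> = 0" using root_of_unity_cases[OF z] G[of z] by (auto simp: a_def b_def S_def)
    finally show "poly P z = poly 0 z" by simp
  qed
  moreover have "Polynomial.coeff P m = D (int m)" if "m < M" for m
    unfolding P_def coeff_sum using that by simp
  ultimately have "D (int m) = 0" if "m < M" for m using that by simp
  from this[of "nat (n mod int M)"] have "D (n mod int M) = 0"
    using M_gt_1 by (simp add: nat_less_iff)
  then have "D n = 0" using periodic_mod[OF perD, of n] by simp
  then show ?thesis by (simp add: D_def algebra_simps)
qed

text \<open>For degree below \<open>M\<close> this is the coefficient sequence modulo
  \<open>x ^ M - 1\<close>, indexed by all integers so that a class modulo \<open>L\<close> becomes
  a two-sided periodic sequence.\<close>

definition periodic_coeff :: "int poly \<Rightarrow> int \<Rightarrow> int" where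
  "periodic_coeff f n = Polynomial.coeff f (nat (n mod int M))"

lemma periodic_coeff_periodic: "periodic (int M) (periodic_coeff f)"
  by (simp add: periodic_def periodic_coeff_def)

lemma poly_eq_sum_periodic_coeff:
  assumes "Polynomial.degree f < M"
  shows "poly (cpoly f) z = (\<Sum>n<M. of_int (periodic_coeff f (int n)) * z ^ n)"
proof -
  have "poly (cpoly f) z = (\<Sum>n\<le>Polynomial.degree f. Polynomial.coeff (cpoly f) n * z ^ n)"
    by (simp add: poly_altdef degree_cpoly)
  also have "\<dots> = (\<Sum>n<M. Polynomial.coeff (cpoly f) n * z ^ n)"
    using assms by (intro sum.mono_neutral_left) (auto simp: coeff_cpoly coeff_eq_0)
  finally show ?thesis by (simp add: periodic_coeff_def coeff_cpoly)
qed

text \<open>\<open>f - r\<close> is a multiple of the cyclotomic polynomial, so its second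
  differences vanish. On a progression with step \<open>L\<close> the shifts \<open>M / p\<close>
  and \<open>M / q\<close> become \<open>q\<close> and \<open>p\<close>, and
  \<open>periodic_split\<close> applies.\<close>

lemma congruent_split:
  assumes "Polynomial.degree f < M" "Polynomial.degree r < M" "cyclotomic_poly M dvd r - f"
  obtains \<alpha> \<beta> :: "int \<Rightarrow> real" where "periodic (int p) \<alpha>" "periodic (int q) \<beta>"
    "\<And>n. real_of_int (periodic_coeff r (n0 + int L * n)) = real_of_int (periodic_coeff f (n0 + int L * n)) - \<alpha> n - \<beta> n"
proof -
  define H where "H = f - r"
  have dH: "Polynomial.degree H < M" unfolding H_def using assms by (intro degree_diff_less)
  have "cyclotomic_poly M dvd H" using assms(3) dvd_minus_iff[of _ "r - f"] by (simp add: H_def)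
  then obtain w where w: "H = cyclotomic_poly M * w" by blast
  have perH: "periodic (int M) (\<lambda>n. of_int (periodic_coeff H n) :: complex)"
    using periodic_coeff_periodic by (simp add: periodic_def)
  have divs: "int (M div p) = int L * int q" "int (M div q) = int L * int p"
    using pos by (simp_all add: M_L)
  have dd: "periodic_coeff H n - periodic_coeff H (n - int L * int q) - periodic_coeff H (n - int L * int p)
     + periodic_coeff H (n - int L * int q - int L * int p) = 0" for n
  proof -
    have "of_int (periodic_coeff H n) - of_int (periodic_coeff H (n - int (M div p))) - of_int (periodic_coeff H (n - int (M div q)))
      + of_int (periodic_coeff H (n - int (M div p) - int (M div q))) = (0 :: complex)"
    proof (rule second_difference_zero[OF perH])
      fix z assume "poly (complex_cyclotomic M) z = 0"
      then have "poly (cpoly H) z = 0" by (simp add: w cpoly_mult of_int_cyclotomic_poly)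
      then show "(\<Sum>n<M. of_int (periodic_coeff H (int n)) * z ^ n) = 0" using poly_eq_sum_periodic_coeff[OF dH] by simp
    qed
    then have "of_int (periodic_coeff H n - periodic_coeff H (n - int L * int q) - periodic_coeff H (n - int L * int p)
     + periodic_coeff H (n - int L * int q - int L * int p)) = (0::complex)" unfolding divs by simp
    then show ?thesis by (subst (asm) of_int_eq_0_iff)
  qed
  define G where "G n = real_of_int (periodic_coeff H (n0 + int L * n))" for n
  have perG: "periodic (int p * int q) G"
    unfolding periodic_def
  proof
    fix n
    have "n0 + int L * (n + int p * int q) = (n0 + int L * n) + int M" by (simp add: M_L algebra_simps)
    then show "G (n + int p * int q) = G n"
      unfolding G_def using periodic_coeff_periodic[of H] unfolding periodic_def by metis
  qed
  have "G n - G (n - int p) - G (n - int q) + G (n - int p - int q) = 0" for n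
  proof -
    have "real_of_int (periodic_coeff H (n0 + int L * n) - periodic_coeff H (n0 + int L * n - int L * int q)
      - periodic_coeff H (n0 + int L * n - int L * int p)
      + periodic_coeff H (n0 + int L * n - int L * int q - int L * int p)) = 0"
      by (subst dd) simp
    then show ?thesis unfolding G_def by (simp add: algebra_simps)
  qed
  moreover have "coprime (int p) (int q)" using coprime_pq by simp
  ultimately obtain \<alpha> \<beta> where
    "periodic (int p) \<alpha>" "periodic (int q) \<beta>" and ab: "\<And>n. G n = \<alpha> n + \<beta> n"
    using periodic_split[OF _ perG] by blast
  then show ?thesis
  proof (intro that)
    fix n show "real_of_int (periodic_coeff r (n0 + int L * n)) = real_of_int (periodic_coeff f (n0 + int L * n)) - \<alpha> n - \<beta> n"
      using ab[of n] by (simp add: G_def H_def periodic_coeff_def)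
  qed
qed

text \<open>The reduced representative has no coefficients from degree \<open>totient M\<close> on,
  so in each class modulo \<open>L\<close> the last \<open>p + q - 1\<close> of \<open>p q\<close>
  places vanish. A strict bound by \<open>d + 1\<close> suffices because coefficients are
  integers.\<close>

lemma inf_norm_le:
  assumes f: "Polynomial.degree f < M"
    and bound: "\<And>n0 F \<alpha> \<beta> n. periodic (int p) \<alpha> \<Longrightarrow> periodic (int q) \<beta> \<Longrightarrow>
      (\<And>n. F n = real_of_int (periodic_coeff f (n0 + int L * n)) - \<alpha> n - \<beta> n) \<Longrightarrow>
      (\<And>e. int ((p - 1) * (q - 1)) \<le> e \<Longrightarrow> e < int ((p - 1) * (q - 1)) + int (p + q) - 1 \<Longrightarrow> F e = 0) \<Longrightarrow>
      \<bar>F n\<bar> < of_int d + 1"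
  shows "inf_norm M (cyclotomic_class M f) \<le> d"
proof -
  let ?u = "cyclotomic_class M f"
  let ?N = "(p - 1) * (q - 1)"
  define r where "r = reduced_rep M ?u"
  have "r \<in> ?u \<and> Polynomial.degree r < totient M"
    unfolding r_def reduced_rep_def
    by (rule theI'[OF ex1_reduced_rep]) (use M_gt_1 in \<open>auto simp: carrier_cyclotomic_ring\<close>)
  then have r: "cyclotomic_poly M dvd r - f" "Polynomial.degree r < totient M"
    by (auto simp: cyclotomic_class_eq)
  have dr: "Polynomial.degree r < M" using r(2) totient_le[of M] by linarith
  have N: "int ?N + int (p + q) - 1 = int p * int q"
    using pos by (cases p; cases q) (simp_all add: algebra_simps)
  have "\<bar>Polynomial.coeff r m\<bar> \<le> d" if m: "m < totient M" for m
  proof -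
    \<comment> \<open>The least residue keeps \<open>n0 + L e\<close> between
      \<open>totient M\<close> and \<open>M - 1\<close> throughout the window.\<close>
    define n0 where "n0 = m mod L"
    obtain \<alpha> \<beta> :: "int \<Rightarrow> real" where ab: "periodic (int p) \<alpha>" "periodic (int q) \<beta>"
      "\<And>n. real_of_int (periodic_coeff r (int n0 + int L * n)) = real_of_int (periodic_coeff f (int n0 + int L * n)) - \<alpha> n - \<beta> n"
      using congruent_split[OF f dr r(1), of "int n0"] by metis
    have "\<bar>real_of_int (periodic_coeff r (int n0 + int L * int (m div L)))\<bar> < of_int d + 1"
    proof (rule bound[OF ab])
      fix e assume e: "int ?N \<le> e" "e < int ?N + int (p + q) - 1"
      have "int n0 < int L" using pos by (simp add: n0_def)
      have "int L * int ?N \<le> int L * e" using e(1) by (intro mult_left_mono) auto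
      then have lo: "int (totient M) \<le> int n0 + int L * e" by (simp add: totient_M)
      have "int L * e \<le> int L * (int p * int q - 1)" using e(2) N by (intro mult_left_mono) auto
      then have "int n0 + int L * e < int M" using \<open>int n0 < int L\<close> by (simp add: M_L algebra_simps)
      then have "periodic_coeff r (int n0 + int L * e) = Polynomial.coeff r (nat (int n0 + int L * e))"
        unfolding periodic_coeff_def using lo by simp
      also have "\<dots> = 0" using lo r(2) by (intro coeff_eq_0) linarith
      finally show "real_of_int (periodic_coeff r (int n0 + int L * e)) = 0" by simp
    qed
    moreover have "int n0 + int L * int (m div L) = int m"
      by (simp add: n0_def flip: of_nat_mult of_nat_add)
    moreover have "int m < int M" using m totient_le[of M] by linarith
    then have "periodic_coeff r (int m) = Polynomial.coeff r m" unfolding periodic_coeff_def by simp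
    ultimately have "real_of_int \<bar>Polynomial.coeff r m\<bar> < real_of_int (d + 1)" by simp
    then show ?thesis by linarith
  qed
  moreover have "totient M > 0" using M_gt_1 by simp
  ultimately show ?thesis
    unfolding inf_norm_def r_def by (subst Max_le_iff) (auto simp: lessThan_empty_iff)
qed

end

subsection \<open>Inverses in the cyclotomic ring\<close>

text \<open>On the block where \<open>r div h = a\<close>, multiplication by \<open>Z - 1\<close>
  telescopes to \<open>a W ^ a (W - 1)\<close> with \<open>W = Z ^ h\<close>. In the remaining sum
  over \<open>a\<close>, the geometric sum of the powers of \<open>W\<close> vanishes and leaves
  \<open>c\<close>.\<close>

lemma sum_div_power:
  fixes Z :: "'a :: field"
  assumes "Z ^ h \<noteq> 1" "Z ^ (c * h) = 1"
  shows "(Z - 1) * (\<Sum>r<c * h. of_nat (r div h) * Z ^ r) = of_nat c"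
proof -
  define W where "W = Z ^ h"
  have W: "W \<noteq> 1" "W ^ c = 1" using assms by (simp_all add: W_def mult.commute flip: power_mult)
  have h: "h > 0" using assms by (intro Nat.gr0I) auto
  have geo: "(Z - 1) * (\<Sum>r<c * h. of_nat (r div h) * Z ^ r) = (W - 1) * (\<Sum>a<c. of_nat a * W ^ a)" for c
  proof (induction c)
    case (Suc c)
    have "Suc c * h = c * h + h" by simp
    then have "(\<Sum>r<Suc c * h. of_nat (r div h) * Z ^ r)
      = (\<Sum>r<c * h. of_nat (r div h) * Z ^ r) + (\<Sum>r=c * h..<c * h + h. of_nat (r div h) * Z ^ r)"
      by (simp only: lessThan_atLeast0 sum.atLeastLessThan_concat le0 le_add1)
    also have "(\<Sum>r=c * h..<c * h + h. of_nat (r div h) * Z ^ r)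
      = (\<Sum>e<h. of_nat ((e + c * h) div h) * Z ^ (e + c * h))"
      using sum.shift_bounds_nat_ivl[of "\<lambda>r. of_nat (r div h) * Z ^ r" 0 "c * h" h]
      by (simp only: add_0 add.commute[of h] lessThan_atLeast0)
    also have "\<dots> = (\<Sum>e<h. of_nat c * W ^ c * Z ^ e)"
    proof (intro sum.cong refl)
      fix e assume "e \<in> {..<h}"
      then have "(e + c * h) div h = c" using h by simp
      moreover have "Z ^ (e + c * h) = W ^ c * Z ^ e"
        by (simp add: W_def power_add mult.commute flip: power_mult)
      ultimately show "of_nat ((e + c * h) div h) * Z ^ (e + c * h) = of_nat c * W ^ c * Z ^ e"
        by (simp add: mult.assoc)
    qed
    also have "\<dots> = of_nat c * W ^ c * (\<Sum>e<h. Z ^ e)"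
      by (simp add: sum_distrib_left)
    finally have "(Z - 1) * (\<Sum>r<Suc c * h. of_nat (r div h) * Z ^ r)
      = (Z - 1) * (\<Sum>r<c * h. of_nat (r div h) * Z ^ r) + of_nat c * W ^ c * ((Z - 1) * (\<Sum>e<h. Z ^ e))"
      by (simp add: algebra_simps)
    also have "(Z - 1) * (\<Sum>e<h. Z ^ e) = W - 1"
      by (simp add: W_def power_diff_1_eq)
    finally have "(Z - 1) * (\<Sum>r<Suc c * h. of_nat (r div h) * Z ^ r)
      = (W - 1) * (\<Sum>a<c. of_nat a * W ^ a) + of_nat c * W ^ c * (W - 1)" unfolding Suc .
    then show ?case by (simp only: sum.lessThan_Suc distrib_left mult.commute)
  qed simp
  have "(W - 1) * (\<Sum>a<c. of_nat a * W ^ a) = of_nat c * W ^ c - W * (\<Sum>a<c. W ^ a)" for c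
    by (induction c) (simp_all add: algebra_simps)
  moreover have "(\<Sum>a<c. W ^ a) = 0"
    using W power_diff_1_eq[of W c] by simp
  ultimately show ?thesis using W by (simp add: geo)
qed

lemma cyclotomic_class_mult:
  "cyclotomic_class M f \<otimes>\<^bsub>cyclotomic_ring M\<^esub> cyclotomic_class M g = cyclotomic_class M (f * g)"
proof -
  interpret R: cring "\<int>[x]" by (rule cring_from_type_algebra)
  interpret ideal "cyclotomic_ideal M" "\<int>[x]"
    unfolding cyclotomic_ideal_def by (rule R.genideal_ideal) (simp add: ring_of_type_algebra_def)
  show ?thesis
    using rcoset_mult_add[of f g]
    by (simp add: cyclotomic_ring_def cyclotomic_class_def FactRing_def)
       (simp add: ring_of_type_algebra_def)
qed

section \<open>Explicit inverses supported on an orbit of exponents\<close>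

context two_prime_powers
begin

text \<open>In the quotient this is \<open>x ^ (- j)\<close> times the sum of \<open>w r x ^ (k r)\<close>.\<close>

definition orbit_sum :: "nat \<Rightarrow> nat \<Rightarrow> nat \<Rightarrow> (nat \<Rightarrow> int) \<Rightarrow> int poly" where
  "orbit_sum k j N w = (\<Sum>r<N. Polynomial.monom (w r) ((k * r + (M - j)) mod M))"

lemma degree_orbit_sum: "Polynomial.degree (orbit_sum k j N w) < M"
  unfolding orbit_sum_def using M_gt_1
  by (intro degree_sum_less le_less_trans[OF degree_monom_le]) auto

lemma poly_orbit_sum:
  assumes z: "z ^ M = 1" and "j \<le> M"
  shows "z ^ j * poly (cpoly (orbit_sum k j N w)) z = (\<Sum>r<N. of_int (w r) * (z ^ k) ^ r)"
proof -
  have red: "z ^ (n mod M) = z ^ n" for n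
  proof -
    have "z ^ n = z ^ (M * (n div M) + n mod M)" by simp
    also have "\<dots> = z ^ (n mod M)" unfolding power_add power_mult z by simp
    finally show ?thesis by simp
  qed
  have "cpoly (\<Sum>r\<in>A. g r) = (\<Sum>r\<in>A. cpoly (g r))" for A :: "nat set" and g
    by (induction A rule: infinite_finite_induct) (simp_all add: cpoly_add)
  then have "poly (cpoly (orbit_sum k j N w)) z = (\<Sum>r<N. of_int (w r) * z ^ (k * r + (M - j)))"
    by (simp add: orbit_sum_def poly_sum map_poly_monom poly_monom red)
  also have "z ^ j * \<dots> = (\<Sum>r<N. of_int (w r) * (z ^ (k * r) * z ^ (j + (M - j))))"
    unfolding sum_distrib_left power_add by (intro sum.cong) (simp_all add: ac_simps)
  finally show ?thesis using assms by (simp add: power_mult)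
qed

text \<open>Index \<open>r\<close> contributes at \<open>n\<close> iff \<open>k r = n + j\<close>
  modulo \<open>M\<close>. This requires \<open>g\<close> to divide \<open>n + j\<close>; then
  \<open>\<kappa>\<close>, an inverse of \<open>k'\<close> modulo \<open>N\<close>, gives exactly
  one \<open>r < N\<close>, so no two terms collide.\<close>

lemma periodic_coeff_orbit_sum:
  fixes k j N g :: nat and \<kappa> :: int
  assumes k: "k = g * k'" and M: "M = g * N" and \<kappa>: "[\<kappa> * int k' = 1] (mod int N)" and "j \<le> M"
  shows "periodic_coeff (orbit_sum k j N w) n =
    (if int g dvd n + int j then w (nat (((n + int j) div int g * \<kappa>) mod int N)) else 0)"
proof -
  have N: "N > 0" "g > 0" using M M_gt_1 by (auto intro: Nat.gr0I)
  have hit: "(k * r + (M - j)) mod M = nat (n mod int M) \<longleftrightarrow> int M dvd int k * int r - (n + int j)" for r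
  proof -
    have "(k * r + (M - j)) mod M = nat (n mod int M) \<longleftrightarrow> int ((k * r + (M - j)) mod M) = n mod int M"
      using M_gt_1 by auto
    also have "\<dots> \<longleftrightarrow> int M dvd (int k * int r - (n + int j)) + int M"
      using \<open>j \<le> M\<close> by (simp add: of_nat_mod of_nat_diff mod_eq_dvd_iff algebra_simps)
    also have "\<dots> \<longleftrightarrow> int M dvd int k * int r - (n + int j)" by simp
    finally show ?thesis .
  qed
  have "periodic_coeff (orbit_sum k j N w) n
      = (\<Sum>r<N. if int M dvd int k * int r - (n + int j) then w r else 0)"
    unfolding periodic_coeff_def orbit_sum_def coeff_sum by (simp add: hit)
  also have "\<dots> = (if int g dvd n + int j then w (nat (((n + int j) div int g * \<kappa>) mod int N)) else 0)"
  proof (cases "int g dvd n + int j")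
    case False
    have "\<not> int M dvd int k * int r - (n + int j)" for r
    proof
      assume "int M dvd int k * int r - (n + int j)"
      then have "int g dvd int k * int r - (n + int j)" using M by (auto elim: dvd_mult_left)
      moreover have "int g dvd int k * int r" using k by simp
      ultimately have "int g dvd n + int j" by (metis dvd_diff_right_iff)
      with False show False by simp
    qed
    then show ?thesis using False by simp
  next
    case True
    then obtain m where m: "n + int j = int g * m" by blast
    define R where "R = nat ((m * \<kappa>) mod int N)"
    have R: "int R = (m * \<kappa>) mod int N" "R < N" using N by (simp_all add: R_def nat_less_iff)
    have "int M dvd int k * int r - (n + int j) \<longleftrightarrow> r = R" if "r < N" for r
    proof -
      have "int M dvd int k * int r - (n + int j) \<longleftrightarrow> int g * int N dvd int g * (int k' * int r - m)"
        by (simp add: M k m algebra_simps)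
      also have "\<dots> \<longleftrightarrow> [int k' * int r = m] (mod int N)"
        using N by (simp add: cong_iff_dvd_diff)
      also have "\<dots> \<longleftrightarrow> [int r = m * \<kappa>] (mod int N)"
      proof
        assume a: "[int k' * int r = m] (mod int N)"
        have "[1 * int r = \<kappa> * int k' * int r] (mod int N)"
          by (rule cong_mult[OF cong_sym[OF \<kappa>]]) simp
        also have "[\<kappa> * int k' * int r = \<kappa> * m] (mod int N)"
          using cong_scalar_left[OF a, of \<kappa>] by (simp add: mult.assoc)
        finally show "[int r = m * \<kappa>] (mod int N)" by (simp add: mult.commute)
      next
        assume a: "[int r = m * \<kappa>] (mod int N)"
        have "[int k' * int r = int k' * (m * \<kappa>)] (mod int N)" by (rule cong_scalar_left[OF a])
        also have "[m * (\<kappa> * int k') = m * 1] (mod int N)" by (rule cong_scalar_left[OF \<kappa>])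
        then have "[int k' * (m * \<kappa>) = m] (mod int N)" by (simp add: ac_simps)
        finally show "[int k' * int r = m] (mod int N)" .
      qed
      also have "\<dots> \<longleftrightarrow> int r = int R" using that by (simp add: cong_def R)
      finally show ?thesis by simp
    qed
    then have "(\<Sum>r<N. if int M dvd int k * int r - (n + int j) then w r else 0)
      = (\<Sum>r<N. if r = R then w r else 0)" by (intro sum.cong) auto
    then show ?thesis using True R(2) N by (simp add: m R_def)
  qed
  finally show ?thesis .
qed

text \<open>The quotient \<open>N div q\<close> is meaningful only when \<open>q\<close> divides \<open>N\<close>; otherwise \<open>x = 0\<close> (and likewise
  for \<open>p\<close> and \<open>y\<close>).\<close>

definition staircase :: "int \<Rightarrow> int \<Rightarrow> nat \<Rightarrow> nat \<Rightarrow> int" where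
  "staircase x y N r = x * int (r div (N div q)) + y * int (r div (N div p))"

text \<open>\<open>z ^ k\<close> has exact order \<open>N\<close>, so \<open>sum_div_power\<close>
  applies to each staircase whose prime divides \<open>N\<close>.\<close>

lemma sum_staircase:
  assumes z: "poly (complex_cyclotomic M) z = 0"
    and k: "k = g * k'" and M: "M = g * N" and cop: "coprime k' N"
    and x: "x = 0 \<or> q dvd N" and y: "y = 0 \<or> p dvd N"
  shows "(z ^ k - 1) * (\<Sum>r<N. of_int (staircase x y N r) * (z ^ k) ^ r)
    = of_int (x * int q + y * int p)"
proof -
  have N: "N > 0" "g > 0" using M M_gt_1 by (auto intro: Nat.gr0I)
  have eq1: "(z ^ k) ^ h = 1 \<longleftrightarrow> N dvd h" for h
  proof -
    have "(z ^ k) ^ h = 1 \<longleftrightarrow> M dvd k * h"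
      using complex_cyclotomic_root_power_eq_1_iff[OF z, of "k * h"] M_gt_1 by (simp add: power_mult)
    also have "\<dots> \<longleftrightarrow> N dvd k' * h" using N by (simp add: M k mult.assoc)
    also have "\<dots> \<longleftrightarrow> N dvd h"
      using cop by (simp add: coprime_dvd_mult_right_iff coprime_commute)
    finally show ?thesis .
  qed
  have part: "of_int v * ((z ^ k - 1) * (\<Sum>r<N. of_nat (r div (N div c)) * (z ^ k) ^ r)) = of_int (v * int c)"
    if "v = 0 \<or> c dvd N" "c > 1" for v c
  proof (cases "v = 0")
    case False
    then have "c dvd N" using that by simp
    then obtain h where h: "N = c * h" by blast
    then have "h > 0" "h < N" using N that by auto
    then have nd: "\<not> N dvd h" using nat_dvd_not_less by blast
    have Nc: "N div c = h" using h that by simp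
    have "(z ^ k) ^ (c * h) = 1" using eq1[of N] unfolding h by (simp only: dvd_refl)
    with nd have "(z ^ k - 1) * (\<Sum>r<c * h. of_nat (r div h) * (z ^ k) ^ r) = of_nat c"
      by (intro sum_div_power) (simp_all only: eq1 not_False_eq_True)
    then have "(z ^ k - 1) * (\<Sum>r<N. of_nat (r div h) * (z ^ k) ^ r) = of_nat c"
      by (simp only: h)
    then show ?thesis unfolding Nc by (simp only: of_int_mult of_int_of_nat_eq)
  qed simp
  have "(\<Sum>r<N. of_int (staircase x y N r) * (z ^ k) ^ r)
    = of_int x * (\<Sum>r<N. of_nat (r div (N div q)) * (z ^ k) ^ r)
    + of_int y * (\<Sum>r<N. of_nat (r div (N div p)) * (z ^ k) ^ r)"
    unfolding staircase_def sum_distrib_left sum.distrib[symmetric]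
    by (intro sum.cong) (simp_all add: distrib_right mult.assoc)
  then have "(z ^ k - 1) * (\<Sum>r<N. of_int (staircase x y N r) * (z ^ k) ^ r)
    = of_int x * ((z ^ k - 1) * (\<Sum>r<N. of_nat (r div (N div q)) * (z ^ k) ^ r))
    + of_int y * ((z ^ k - 1) * (\<Sum>r<N. of_nat (r div (N div p)) * (z ^ k) ^ r))"
    by (simp only: distrib_left mult.left_commute)
  then show ?thesis unfolding part[OF x pos(2)] part[OF y pos(1)] by (simp only: of_int_add)
qed

text \<open>Coefficients \<open>(1, 0)\<close> produce the constant \<open>q\<close>, Bezout
  coefficients the constant 1. The congruence is checked at the roots of the cyclotomic
  polynomial.\<close>

lemma orbit_sum_inverse:
  assumes k: "k = g * k'" and M: "M = g * N" and cop: "coprime k' N" and j: "j \<le> M"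
    and xy: "x = 0 \<or> q dvd N" "y = 0 \<or> p dvd N"
  shows "cyclotomic_class M (Polynomial.monom 1 (j + k) - Polynomial.monom 1 j)
      \<otimes>\<^bsub>cyclotomic_ring M\<^esub> cyclotomic_class M (orbit_sum k j N (staircase x y N))
    = cyclotomic_class M [:x * int q + y * int p:]"
proof -
  let ?f = "orbit_sum k j N (staircase x y N)"
  let ?h = "Polynomial.monom 1 (j + k) - Polynomial.monom 1 j :: int poly"
  let ?c = "x * int q + y * int p"
  have D: "cyclotomic_poly M dvd ?h * ?f - [:?c:]"
  proof (rule cyclotomic_poly_dvdI[OF M_gt_1])
    fix z assume z: "poly (complex_cyclotomic M) z = 0"
    then have zM: "z ^ M = 1" using complex_cyclotomic_root_power_eq_1_iff[OF z, of M] M_gt_1 by simp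
    have "poly (cpoly (?h * ?f)) z = (z ^ k - 1) * (z ^ j * poly (cpoly ?f) z)"
      by (simp add: cpoly_mult cpoly_diff map_poly_monom poly_monom power_add algebra_simps)
    also have "\<dots> = of_int ?c"
      unfolding poly_orbit_sum[OF zM j] by (rule sum_staircase[OF z k M cop xy])
    finally show "poly (cpoly (?h * ?f - [:?c:])) z = 0" by (simp add: cpoly_diff map_poly_pCons)
  qed
  have "cyclotomic_poly M dvd g - ?h * ?f \<longleftrightarrow> cyclotomic_poly M dvd g - [:?c:]" for g
  proof -
    have "g - [:?c:] = (g - ?h * ?f) + (?h * ?f - [:?c:])" by (simp only: diff_add_eq diff_add_cancel add_diff_eq)
    then show ?thesis using dvd_add_left_iff[OF D] by (simp only:)
  qed
  then show ?thesis unfolding cyclotomic_class_mult by (simp add: cyclotomic_class_eq)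
qed

section \<open>The three cases of the theorem\<close>

lemma prime_dvd_order:
  assumes "k = g * k'" "M = g * N" "prime r" "r ^ a dvd M" "\<not> r ^ a dvd k"
  shows "r dvd N"
proof (rule ccontr)
  assume "\<not> r dvd N"
  \<comment> \<open>Otherwise the full power \<open>r ^ a\<close> would sit in \<open>g\<close>,
    which divides \<open>k\<close>.\<close>
  then have "coprime (r ^ a) N" using assms(3) by (simp add: prime_imp_coprime)
  then have "r ^ a dvd g" using assms by (simp add: coprime_dvd_mult_left_iff)
  then show False using assms by simp
qed

text \<open>\<open>k < M\<close> excludes \<open>q ^ t dvd k\<close>, so \<open>q\<close> divides
  the order \<open>N\<close> and the staircase has levels \<open>0..q - 1\<close>. As
  \<open>p ^ s\<close> divides \<open>g\<close>, \<open>bound_single_class\<close> applies on each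
  class modulo \<open>L\<close>.\<close>

lemma inverse_prime:
  assumes k: "0 < k" "k < M" "p ^ s dvd k" and j: "j \<le> M"
  shows "\<exists>u\<in>carrier (cyclotomic_ring M).
    cyclotomic_class M (Polynomial.monom 1 (j + k) - Polynomial.monom 1 j)
      \<otimes>\<^bsub>cyclotomic_ring M\<^esub> u = cyclotomic_class M [:int q:] \<and> inf_norm M u \<le> int q - 1"
proof -
  define g where "g = gcd k M"
  have "gcd k M \<noteq> 0" using M_gt_1 by simp
  from gcd_coprime_exists[OF this] obtain k' N
    where "k = k' * g" "M = N * g" and cop: "coprime k' N" unfolding g_def by blast
  then have kN: "k = g * k'" "M = g * N" by (simp_all only: mult.commute)
  have N: "N > 0" "g > 0" using kN(2) M_gt_1 by (auto intro: Nat.gr0I)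
  obtain \<kappa> where \<kappa>: "[\<kappa> * int k' = 1] (mod int N)"
    using cong_solve_coprime_int[of "int k'" "int N"] cop by (auto simp: mult.commute)
  have "\<not> q ^ t dvd k"
  proof
    assume "q ^ t dvd k"
    then have "M dvd k" unfolding M_eq using k coprime_pq by (intro divides_mult) auto
    then show False using k by (auto dest: dvd_imp_le)
  qed
  then have qN: "q dvd N" using prime_dvd_order[OF kN q, of t] by (simp add: M_eq)
  have psg: "p ^ s dvd g" using k(3) by (simp add: g_def M_eq)
  define f where "f = orbit_sum k j N (staircase 1 0 N)"
  define R where "R n = ((n + int j) div int g * \<kappa>) mod int N" for n
  have f: "periodic_coeff f n = (if int g dvd n + int j then staircase 1 0 N (nat (R n)) else 0)" for n
    unfolding f_def R_def by (rule periodic_coeff_orbit_sum[OF kN \<kappa> j])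
  have R: "0 \<le> R n" "R n < int N" for n using N by (simp_all add: R_def)
  have rng: "0 \<le> periodic_coeff f n" "periodic_coeff f n \<le> int q - 1" for n
  proof -
    obtain h where h: "N = q * h" using qN by blast
    have "nat (R n) div h < q" using R[of n] h N by (simp add: less_mult_imp_div_less nat_less_iff)
    then show "0 \<le> periodic_coeff f n" "periodic_coeff f n \<le> int q - 1" using pos N h by (auto simp: f staircase_def)
  qed
  have "inf_norm M (cyclotomic_class M f) \<le> int q - 1"
  proof (rule inf_norm_le)
    show "Polynomial.degree f < M" unfolding f_def by (rule degree_orbit_sum)
    fix n0 :: int and F \<alpha> \<beta> :: "int \<Rightarrow> real" and n :: int
    assume \<alpha>: "periodic (int p) \<alpha>" and \<beta>: "periodic (int q) \<beta>"
      and F: "\<And>n. F n = real_of_int (periodic_coeff f (n0 + int L * n)) - \<alpha> n - \<beta> n"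
      and window: "\<And>e. int ((p - 1) * (q - 1)) \<le> e \<Longrightarrow>
        e < int ((p - 1) * (q - 1)) + int (p + q) - 1 \<Longrightarrow> F e = 0"
    \<comment> \<open>Two indices in the support satisfy \<open>g dvd L * (n - a)\<close>;
      \<open>L\<close> carries only \<open>s - 1\<close> factors \<open>p\<close>, so
      \<open>p\<close> divides \<open>n - a\<close>. If the class misses the support, any
      \<open>a\<close> serves.\<close>
    have "\<exists>a. \<forall>n. int g dvd n0 + int L * n + int j \<longrightarrow> n mod int p = a mod int p"
    proof (cases "\<exists>a. int g dvd n0 + int L * a + int j")
      case True
      then obtain a where a: "int g dvd n0 + int L * a + int j" by blast
      have "n mod int p = a mod int p" if "int g dvd n0 + int L * n + int j" for n
      proof -
        have "int g dvd (n0 + int L * n + int j) - (n0 + int L * a + int j)"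
          using a that by (rule dvd_diff[rotated])
        then have "int g dvd int L * (n - a)" by (simp add: algebra_simps)
        moreover have "int (p ^ s) dvd int g" using psg by (simp only: of_nat_dvd_iff)
        ultimately have "int (p ^ s) dvd int L * (n - a)" by (rule dvd_trans[rotated])
        moreover have "int (p ^ s) = int (p ^ (s - 1)) * int p" using s by (simp add: power_eq_if)
        ultimately have "int (p ^ (s - 1)) * int p dvd int (p ^ (s - 1)) * (int (q ^ (t - 1)) * (n - a))"
          by (simp add: L_def mult.assoc)
        then have "int p dvd int (q ^ (t - 1)) * (n - a)" using pos by simp
        moreover have "coprime (int p) (int (q ^ (t - 1)))" using coprime_pq by simp
        ultimately have "int p dvd n - a" using coprime_dvd_mult_right_iff by blast
        then show ?thesis by (simp add: mod_eq_dvd_iff)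
      qed
      then show ?thesis by blast
    qed blast
    then obtain a where a: "\<And>n. int g dvd n0 + int L * n + int j \<Longrightarrow> n mod int p = a mod int p"
      by blast
    have "\<bar>F n\<bar> \<le> real q - 1"
    proof (rule bound_single_class[OF coprime_pq _ _ \<alpha> \<beta> F window])
      fix n
      show "0 \<le> real_of_int (periodic_coeff f (n0 + int L * n))" using rng by simp
      have "real_of_int (periodic_coeff f (n0 + int L * n)) \<le> real_of_int (int q - 1)"
        using rng by (simp only: of_int_le_iff)
      then show "real_of_int (periodic_coeff f (n0 + int L * n)) \<le> real q - 1" by simp
      show "real_of_int (periodic_coeff f (n0 + int L * n)) = 0" if "n mod int p \<noteq> a mod int p"
        using a[of n] that by (auto simp: f)
    qed (use pos in auto)
    then show "\<bar>F n\<bar> < of_int (int q - 1) + 1" by simp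
  qed
  then show ?thesis
    using orbit_sum_inverse[OF kN cop j, of 1 0] qN
    by (intro bexI[of _ "cyclotomic_class M f"]) (auto simp: f_def carrier_cyclotomic_ring)
qed

text \<open>Both primes divide \<open>N\<close>. Splitting each floor into quotient and remainder
  turns the coefficients into \<open>S / N\<close> up to a \<open>p\<close>-periodic and a
  \<open>q\<close>-periodic function. The Bezout coefficients survive only in these, so their size
  does not affect the bound.\<close>

lemma inverse_unit:
  assumes k: "\<not> p ^ s dvd k" "\<not> q ^ t dvd k" and j: "j \<le> M"
  shows "\<exists>u\<in>carrier (cyclotomic_ring M).
    cyclotomic_class M (Polynomial.monom 1 (j + k) - Polynomial.monom 1 j)
      \<otimes>\<^bsub>cyclotomic_ring M\<^esub> u = cyclotomic_class M [:1:] \<and> inf_norm M u \<le> int p - 1"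
proof -
  define g where "g = gcd k M"
  have "gcd k M \<noteq> 0" using M_gt_1 by simp
  from gcd_coprime_exists[OF this] obtain k' N
    where "k = k' * g" "M = N * g" and cop: "coprime k' N" unfolding g_def by blast
  then have kN: "k = g * k'" "M = g * N" by (simp_all only: mult.commute)
  have N: "N > 0" "g > 0" using kN(2) M_gt_1 by (auto intro: Nat.gr0I)
  obtain \<kappa> where \<kappa>: "[\<kappa> * int k' = 1] (mod int N)"
    using cong_solve_coprime_int[of "int k'" "int N"] cop by (auto simp: mult.commute)
  have qN: "q dvd N" and pN: "p dvd N"
    using prime_dvd_order[OF kN q, of t] prime_dvd_order[OF kN p, of s] k by (simp_all add: M_eq)
  then have "p * q dvd N" using coprime_pq by (intro divides_mult)
  then obtain h where h: "N = p * q * h" by blast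
  then have h0: "h > 0" using N by auto
  \<comment> \<open>Since \<open>g\<close> divides \<open>L\<close>, a class modulo \<open>L\<close>
    is either missed by the orbit or met at every place.\<close>
  have L: "L = g * h" using M_L pos by (simp add: kN(2) h)
  obtain x y where xy: "x * int q + y * int p = 1"
    using bezout_int[of "int q" "int p"] coprime_pq by (metis coprime_iff_gcd_eq_1 coprime_int_iff gcd.commute)
  define f where "f = orbit_sum k j N (staircase x y N)"
  define R where "R n = ((n + int j) div int g * \<kappa>) mod int N" for n
  have f: "periodic_coeff f n = (if int g dvd n + int j then staircase x y N (nat (R n)) else 0)" for n
    unfolding f_def R_def by (rule periodic_coeff_orbit_sum[OF kN \<kappa> j])
  have "inf_norm M (cyclotomic_class M f) \<le> int p - 1"
  proof (rule inf_norm_le)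
    show "Polynomial.degree f < M" unfolding f_def by (rule degree_orbit_sum)
    fix n0 :: int and F \<alpha> \<beta> :: "int \<Rightarrow> real" and n :: int
    assume \<alpha>: "periodic (int p) \<alpha>" and \<beta>: "periodic (int q) \<beta>"
      and F: "\<And>n. F n = real_of_int (periodic_coeff f (n0 + int L * n)) - \<alpha> n - \<beta> n"
      and window: "\<And>e. int ((p - 1) * (q - 1)) \<le> e \<Longrightarrow>
        e < int ((p - 1) * (q - 1)) + int (p + q) - 1 \<Longrightarrow> F e = 0"
    have split: "n0 + int L * n + int j = (n0 + int j) + int g * (int h * n)" for n
      by (simp add: L)
    have "\<bar>F n\<bar> < real p"
    proof (cases "int g dvd n0 + int j")
      case False
      then have "\<not> int g dvd n0 + int L * n + int j" for n
        unfolding split by (simp add: dvd_add_left_iff)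
      \<comment> \<open>A missed class is the case \<open>\<rho> = 0\<close>.\<close>
      then have F0: "F n = 0 - \<alpha> n - \<beta> n" for n using F[of n] by (simp add: f)
      show ?thesis
        by (rule bound_unit_interval[OF coprime_pq _ _ \<alpha> \<beta> F0 window]) (use pos in auto)
    next
      case True
      then obtain A where A: "n0 + int j = int g * A" by blast
      define S where "S n = ((A + int h * n) * \<kappa>) mod int N" for n
      have gd: "n0 + int L * n + int j = int g * (A + int h * n)" for n
        unfolding split A by (simp add: algebra_simps)
      have fS: "periodic_coeff f (n0 + int L * n) = staircase x y N (nat (S n))" for n
        unfolding f R_def gd S_def using N by simp
      have S: "0 \<le> S n" "S n < int N" for n using N by (simp_all add: S_def)
      \<comment> \<open>As \<open>c h\<close> divides \<open>N\<close>, reduction modulo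
        \<open>N\<close> preserves the remainder modulo \<open>c h\<close>, and replacing
        \<open>n\<close> by \<open>n + c\<close> adds a multiple of \<open>c h\<close>.\<close>
      have per: "periodic (int c) (\<lambda>n. real_of_int (v * (S n mod int (c * h))) / real (c * h))"
        if "c * h dvd N" for c v
        unfolding periodic_def
      proof
        fix n
        have red: "S n mod int (c * h) = ((A + int h * n) * \<kappa>) mod int (c * h)" for n
          unfolding S_def using that by (intro mod_mod_cancel) (simp only: of_nat_dvd_iff)
        have "(A + int h * (n + int c)) * \<kappa> = (A + int h * n) * \<kappa> + \<kappa> * int (c * h)"
          by (simp add: algebra_simps)
        then have "S (n + int c) mod int (c * h) = S n mod int (c * h)"
          unfolding red by (simp only: mod_mult_self1)
        then show "real_of_int (v * (S (n + int c) mod int (c * h))) / real (c * h)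
          = real_of_int (v * (S n mod int (c * h))) / real (c * h)" by simp
      qed
      \<comment> \<open>The indices cross over: the staircase for \<open>q\<close> has steps of
        length \<open>N / q = p h\<close>, so its remainders are \<open>p\<close>-periodic and join
        \<open>\<alpha>\<close>.\<close>
      define \<alpha>' where "\<alpha>' n = \<alpha> n + real_of_int (x * (S n mod int (p * h))) / real (p * h)" for n
      define \<beta>' where "\<beta>' n = \<beta> n + real_of_int (y * (S n mod int (q * h))) / real (q * h)" for n
      have "periodic (int p) \<alpha>'" using \<alpha> per[of p x] h by (simp add: periodic_def \<alpha>'_def)
      moreover have "periodic (int q) \<beta>'" using \<beta> per[of q y] h by (simp add: periodic_def \<beta>'_def)
      moreover have "F n = real_of_int (S n) / real N - \<alpha>' n - \<beta>' n" for n
      proof -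
        have dv: "real_of_int (S n div int m) = (real_of_int (S n) - real_of_int (S n mod int m)) / real m"
          if "m > 0" for m
        proof -
          have "S n = int m * (S n div int m) + S n mod int m" by simp
          then have "real_of_int (S n) = real m * real_of_int (S n div int m) + real_of_int (S n mod int m)"
            by (metis of_int_add of_int_mult of_int_of_nat_eq)
          then show ?thesis using that by (simp add: field_simps)
        qed
        have "N div q = p * h" "N div p = q * h" using pos by (simp_all add: h)
        then have "periodic_coeff f (n0 + int L * n) = x * (S n div int (p * h)) + y * (S n div int (q * h))"
          using S[of n] by (simp add: fS staircase_def zdiv_int)
        then have "real_of_int (periodic_coeff f (n0 + int L * n))
          = of_int x * ((real_of_int (S n) - real_of_int (S n mod int (p * h))) / real (p * h))
          + of_int y * ((real_of_int (S n) - real_of_int (S n mod int (q * h))) / real (q * h))"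
          using dv[of "p * h"] dv[of "q * h"] pos h0 by simp
        moreover have "of_int x * (real_of_int (S n) / real (p * h)) + of_int y * (real_of_int (S n) / real (q * h))
          = real_of_int (S n) / real N"
        proof -
          have "of_int x * (real_of_int (S n) / real (p * h)) + of_int y * (real_of_int (S n) / real (q * h))
            = real_of_int (x * int q + y * int p) * real_of_int (S n) / real N"
            using pos h0 by (simp add: h field_simps)
          then show ?thesis unfolding xy by simp
        qed
        ultimately show ?thesis unfolding F \<alpha>'_def \<beta>'_def by (simp add: diff_divide_distrib algebra_simps)
      qed
      moreover have "real_of_int (S n) / real N < 1" for n
      proof -
        have "real_of_int (S n) < real_of_int (int N)" using S by (simp only: of_int_less_iff)
        then show ?thesis using N by simp
      qed
      ultimately show ?thesis
        using S by (intro bound_unit_interval[OF coprime_pq _ _ _ _ _ window]) (use pos in auto)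
    qed
    then show "\<bar>F n\<bar> < of_int (int p - 1) + 1" by simp
  qed
  then show ?thesis
    using orbit_sum_inverse[OF kN cop j, of x y] qN pN
    by (intro bexI[of _ "cyclotomic_class M f"]) (auto simp: f_def xy carrier_cyclotomic_ring)
qed

end

theorem theorem3:
  fixes p q s t M i j :: nat
  assumes "prime p" and "prime q" and "p < q"
    and "s > 0" and "t > 0" and "M = p ^ s * q ^ t"
    and "j < i" and "i < M"
  shows "let (c, d) = (if p ^ s dvd i - j then (int q, int q - 1)
                       else if q ^ t dvd i - j then (int p, int p - 1)
                       else (1, int p - 1))
         in \<exists>u\<in>carrier (cyclotomic_ring M).
              cyclotomic_class M (Polynomial.monom 1 i - Polynomial.monom 1 j)
                \<otimes>\<^bsub>cyclotomic_ring M\<^esub> u = cyclotomic_class M [:c:]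
              \<and> inf_norm M u \<le> d"
proof -
  interpret pq: two_prime_powers p q s t M using assms by unfold_locales auto
  \<comment> \<open>Exchanging the primes turns the first case into the second, with constant
    \<open>p\<close> and bound \<open>p - 1\<close>.\<close>
  interpret qp: two_prime_powers q p t s M using assms by unfold_locales auto
  have k: "0 < i - j" "i - j < M" "j \<le> M" and i: "j + (i - j) = i" using assms by auto
  show ?thesis
    using pq.inverse_prime[OF k(1,2) _ k(3)] qp.inverse_prime[OF k(1,2) _ k(3)]
      pq.inverse_unit[OF _ _ k(3), of "i - j"]
    unfolding i by simp
qed

end
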